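(* For all integers $k\ge 3$ we have $f(2,k)=\infty$.
   Context: A permutation is any finite sequence of distinct integers. Two permutations $(x_1,\dots,x_k)$ and $(y_1,\dots,y_k)$ of the same length are similar if $x_i<x_j$ if and only if $y_i<y_j$ for all $1\le i<j\le k$. For an integer $r\ge 2$, a collection of $r$ pairwise disjoint (occupying pairwise disjoint sets of positions), pairwise similar subsequences of a permutation $\pi$, each of length $k$, forms tight $r$-twins of length $k$ in $\pi$ if the union of the positions they occupy is a segment of consecutive positions of $\pi$ (of length $rk$). For integers $r,k\ge2$, $f(r,k)$ is the minimum $n$ such that every permutation of length $n$ contains tight $r$-twins of length exactly $k$; if no such $n$ exists, $f(r,k)=\infty$. *)

theory Defs
  imports Main "HOL-Library.Extended_Nat" "HOL-Library.Disjoint_Sets"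
begin

definition permutation :: "int list \<Rightarrow> bool" where
  "permutation xs \<longleftrightarrow> distinct xs"

definition similar :: "int list \<Rightarrow> int list \<Rightarrow> bool" where
  "similar xs ys \<longleftrightarrow> length xs = length ys \<and>
     (\<forall>i j. i < j \<and> j < length xs \<longrightarrow> (xs ! i < xs ! j \<longleftrightarrow> ys ! i < ys ! j))"

text \<open>A subsequence is given by the set of positions it occupies; positions are counted from 0,
  and \<open>P t\<close> is the position set of the \<open>t\<close>-th twin. The segment starts at position \<open>a\<close>.\<close>

definition is_tight_twins :: "nat \<Rightarrow> nat \<Rightarrow> int list \<Rightarrow> (nat \<Rightarrow> nat set) \<Rightarrow> bool" where
  "is_tight_twins r k xs P \<longleftrightarrow>
     (\<forall>t<r. P t \<subseteq> {..<length xs} \<and> card (P t) = k) \<and>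
     disjoint_family_on P {..<r} \<and>
     (\<forall>s<r. \<forall>t<r. similar (nths xs (P s)) (nths xs (P t))) \<and>
     (\<exists>a. (\<Union>t<r. P t) = {a..<a + r * k})"

definition contains_tight_twins :: "nat \<Rightarrow> nat \<Rightarrow> int list \<Rightarrow> bool" where
  "contains_tight_twins r k xs \<longleftrightarrow> (\<exists>P. is_tight_twins r k xs P)"

definition forces_tight_twins :: "nat \<Rightarrow> nat \<Rightarrow> nat \<Rightarrow> bool" where
  "forces_tight_twins r k n \<longleftrightarrow>
     (\<forall>xs. permutation xs \<and> length xs = n \<longrightarrow> contains_tight_twins r k xs)"

text \<open>The quantity \<open>f(r,k)\<close>, intended for \<open>r \<ge> 2\<close> and \<open>k \<ge> 2\<close>.\<close>

definition tight_twin_number :: "nat \<Rightarrow> nat \<Rightarrow> enat" where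
  "tight_twin_number r k =
     (if \<exists>n. forces_tight_twins r k n then enat (LEAST n. forces_tight_twins r k n) else \<infinity>)"

end

theory Submission
  imports Defs
begin

text \<open>
  For every length there is a permutation without tight twins of length \<open>k\<close>. It is layered: values
  increase from block to block and decrease inside each block, and the block sizes alternate
  between \<open>1\<close> and \<open>2 * k - 3\<close>. Two entries are then inverted exactly when they share a block, so a
  pair of tight twins splits a window of \<open>2 * k\<close> positions into two halves whose inversion graphs
  agree under the order isomorphism between the halves.

  The period \<open>2 * k - 2\<close> is so close to the window length that only two kinds of window exist.
  Either a block of size \<open>1\<close> lies in the window with at least two positions on each side of it, and
  then those two sides are decreasing runs; or the window consists of one complete block of size
  \<open>2 * k - 3\<close> and three blocks of size \<open>1\<close>. The lemma \<open>no_twins_around_isolated_position\<close> excludes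
  the first kind, since no entry of the other half can play the role of the isolated one. The lemma
  \<open>no_twins_with_one_odd_clique\<close> excludes the second: both halves would have to meet the long block
  in equally many positions, but its size is odd.
\<close>

section \<open>Twins as a pair of increasing enumerations\<close>

text \<open>
  The halves of a window are listed by the increasing functions \<open>\<alpha>\<close> and \<open>\<beta>\<close>. Only the inversion
  relation \<open>R\<close> of the permutation matters for similarity, so the values themselves are left out.
\<close>

definition twin_enumerations ::
    "(nat \<Rightarrow> nat \<Rightarrow> bool) \<Rightarrow> nat \<Rightarrow> nat \<Rightarrow> (nat \<Rightarrow> nat) \<Rightarrow> (nat \<Rightarrow> nat) \<Rightarrow> bool" where
  "twin_enumerations R a k \<alpha> \<beta> \<longleftrightarrow>
     strict_mono_on {..<k} \<alpha> \<and> strict_mono_on {..<k} \<beta> \<and>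
     \<alpha> ` {..<k} \<inter> \<beta> ` {..<k} = {} \<and> \<alpha> ` {..<k} \<union> \<beta> ` {..<k} = {a..<a + 2 * k} \<and>
     (\<forall>i j. i < j \<and> j < k \<longrightarrow> (R (\<alpha> i) (\<alpha> j) \<longleftrightarrow> R (\<beta> i) (\<beta> j)))"

lemma twin_enumerations_sym:
  "twin_enumerations R a k \<alpha> \<beta> \<Longrightarrow> twin_enumerations R a k \<beta> \<alpha>"
  unfolding twin_enumerations_def by (simp add: Int_commute Un_commute)

lemma nths_eq_map_sorted_list_of_set:
  assumes "A \<subseteq> {..<length xs}"
  shows "nths xs A = map ((!) xs) (sorted_list_of_set A)"
proof -
  have "nths xs A = map ((!) xs) (filter (\<lambda>i. i \<in> A) [0..<length xs])"
  proof (induction xs rule: rev_induct)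
    case (snoc x xs)
    have "map ((!) (xs @ [x])) (filter (\<lambda>i. i \<in> A) [0..<length xs])
        = map ((!) xs) (filter (\<lambda>i. i \<in> A) [0..<length xs])"
      by (auto simp: nth_append)
    with snoc show ?case
      by (simp add: nths_append nths_singleton)
  qed simp
  moreover have "filter (\<lambda>i. i \<in> A) [0..<length xs] = sorted_list_of_set A"
  proof (rule sorted_distinct_set_unique)
    show "set (filter (\<lambda>i. i \<in> A) [0..<length xs]) = set (sorted_list_of_set A)"
      using assms finite_subset[OF assms] by auto
  qed (auto intro: sorted_wrt_filter)
  ultimately show ?thesis by simp
qed

lemma tight_twins_enumerations:
  assumes "is_tight_twins 2 k xs P"
  obtains a \<alpha> \<beta> where "a + 2 * k \<le> length xs"
    "twin_enumerations (\<lambda>p q. \<not> xs ! p < xs ! q) a k \<alpha> \<beta>"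
proof -
  have sub: "P t \<subseteq> {..<length xs}" and card: "card (P t) = k" if "t < 2" for t
    using assms that by (auto simp: is_tight_twins_def)
  have fin: "finite (P t)" if "t < 2" for t
    using sub[OF that] finite_subset by blast
  define e where "e t = (!) (sorted_list_of_set (P t))" for t
  have len: "length (sorted_list_of_set (P t)) = k" if "t < 2" for t
    using card[OF that] by simp
  have mono: "strict_mono_on {..<k} (e t)" if "t < 2" for t
    unfolding e_def strict_mono_on_def
    using len[OF that] strict_sorted_list_of_set[of "P t"] by (auto simp: sorted_wrt_iff_nth_less)
  have img: "e t ` {..<k} = P t" if "t < 2" for t
  proof -
    have "e t ` {..<k} = set (sorted_list_of_set (P t))"
      unfolding e_def using len[OF that] by (force simp: set_conv_nth)
    then show ?thesis using fin[OF that] by simp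
  qed
  have nths: "nths xs (P t) ! i = xs ! e t i" if "t < 2" "i < k" for t i
    using nths_eq_map_sorted_list_of_set[OF sub[OF that(1)]] len[OF that(1)] that(2)
    by (simp add: e_def)
  have "length (nths xs (P 0)) = k"
    using nths_eq_map_sorted_list_of_set[OF sub[of 0]] len[of 0] by simp
  moreover have "similar (nths xs (P 0)) (nths xs (P 1))"
    using assms by (simp add: is_tight_twins_def)
  ultimately have sim: "xs ! e 0 i < xs ! e 0 j \<longleftrightarrow> xs ! e 1 i < xs ! e 1 j"
    if "i < j" "j < k" for i j
    using that nths[of 0] nths[of 1] by (auto simp: similar_def)
  obtain a where "(\<Union>t<2. P t) = {a..<a + 2 * k}"
    using assms by (auto simp: is_tight_twins_def)
  moreover have "(\<Union>t<2. P t) = P 0 \<union> P 1"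
    by (auto simp: less_2_cases_iff)
  ultimately have un: "P 0 \<union> P 1 = {a..<a + 2 * k}" by simp
  have "P 0 \<inter> P 1 = {}"
    using assms unfolding is_tight_twins_def disjoint_family_on_def by auto
  then have *: "twin_enumerations (\<lambda>p q. \<not> xs ! p < xs ! q) a k (e 0) (e 1)"
    unfolding twin_enumerations_def using mono[of 0] mono[of 1] img[of 0] img[of 1] un sim by simp
  show ?thesis
  proof (cases "k = 0 \<and> a > length xs")
    case True
    \<comment> \<open>For \<open>k = 0\<close> the segment is empty, and its start is then arbitrary.\<close>
    then show ?thesis
      by (intro that[of 0 "e 0" "e 1"]) (auto simp: twin_enumerations_def strict_mono_on_def)
  next
    case False
    have "{a..<a + 2 * k} \<subseteq> {..<length xs}"
      using un sub[of 0] sub[of 1] by auto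
    with False have "a + 2 * k \<le> length xs"
      by (cases "k = 0") (auto dest: subsetD[of _ _ "a + 2 * k - 1"])
    with * show ?thesis by (rule that[rotated])
  qed
qed

section \<open>Windows without twins\<close>

text \<open>
  Let \<open>\<alpha> i = s\<close>. The partner \<open>\<beta> i\<close> must be isolated within its half, although everything on its
  side of \<open>s\<close> is inverted with it. Hence it is the only element of its half there, and, say for
  \<open>\<beta> i < s\<close>, this makes it the first one. So \<open>s\<close> is the first element of the other half, and
  the positions before \<open>s\<close> all belong to the half of \<open>\<beta> i\<close>; there are at least two of them, so
  \<open>\<beta> i\<close> was not alone. The other side is the mirror image.
\<close>

lemma no_twins_around_isolated_position:
  assumes s: "a + 2 \<le> s" "s + 3 \<le> a + 2 * k"
    and left: "\<And>p q. a \<le> p \<Longrightarrow> p < q \<Longrightarrow> q < s \<Longrightarrow> R p q"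
    and right: "\<And>p q. s < p \<Longrightarrow> p < q \<Longrightarrow> q < a + 2 * k \<Longrightarrow> R p q"
    and isolated: "\<And>p. p < s \<Longrightarrow> \<not> R p s" "\<And>p. s < p \<Longrightarrow> \<not> R s p"
  shows "\<not> twin_enumerations R a k \<alpha> \<beta>"
proof
  have False if tw: "twin_enumerations R a k \<alpha> \<beta>" and i: "i < k" "\<alpha> i = s" for \<alpha> \<beta> i
  proof -
    have less: "\<alpha> u < \<alpha> v" "\<beta> u < \<beta> v" if "u < v" "v < k" for u v
      using tw that by (auto simp: twin_enumerations_def strict_mono_on_def)
    have R: "R (\<alpha> u) (\<alpha> v) \<longleftrightarrow> R (\<beta> u) (\<beta> v)" if "u < v" "v < k" for u v
      using tw that by (auto simp: twin_enumerations_def)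
    have range: "a \<le> \<beta> u" "\<beta> u < a + 2 * k" if "u < k" for u
      using tw that unfolding twin_enumerations_def by (metis UnI2 atLeastLessThan_iff imageI lessThan_iff)+
    have cover: "(\<exists>u<k. p = \<alpha> u) \<or> (\<exists>u<k. p = \<beta> u)" if "a \<le> p" "p < a + 2 * k" for p
    proof -
      have "p \<in> \<alpha> ` {..<k} \<union> \<beta> ` {..<k}"
        using tw that by (simp add: twin_enumerations_def)
      then show ?thesis by auto
    qed
    have no_before: "\<not> R (\<beta> u) (\<beta> i)" if "u < i" for u
      using R[OF that] i isolated(1) less(1)[OF that] by simp
    have no_after: "\<not> R (\<beta> i) (\<beta> u)" if "i < u" "u < k" for u
      using R[OF that] i isolated(2) less(1)[OF that] by simp
    have "\<beta> i \<noteq> \<alpha> i"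
      using tw i unfolding twin_enumerations_def by blast
    then consider "\<beta> i < s" | "\<beta> i > s" using i by linarith
    then show False
    proof cases
      case 1
      have "i = 0"
      proof (rule ccontr)
        assume "i \<noteq> 0"
        then have "0 < i" by simp
        then show False
          using no_before left[OF range(1)[of 0] less(2)] i 1 by auto
      qed
      have "\<exists>u<k. p = \<beta> u" if "a \<le> p" "p < s" for p
      proof -
        have "p \<noteq> \<alpha> u" if "u < k" for u
          using less(1)[of 0 u] \<open>p < s\<close> i \<open>i = 0\<close> that by (cases "u = 0") auto
        then show ?thesis using cover[of p] that s by auto
      qed
      from this[of a] this[of "a + 1"] obtain u v
        where uv: "u < k" "v < k" "a = \<beta> u" "a + 1 = \<beta> v" using s by auto
      then have "u < v" using less(2)[of v u] by (cases u v rule: linorder_cases) auto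
      then have "R (\<beta> 0) (\<beta> v)"
        using left[OF range(1)[of 0] less(2)[of 0 v]] uv s by simp
      then show False using no_after[of v] \<open>i = 0\<close> \<open>u < v\<close> uv by simp
    next
      case 2
      have i_last: "i = k - 1"
      proof (rule ccontr)
        assume "i \<noteq> k - 1"
        then have "i < k - 1" "k - 1 < k" using i by auto
        then show False
          using no_after right[OF 2 less(2) range(2)[of "k - 1"]] by auto
      qed
      have "\<exists>u<k. p = \<beta> u" if "s < p" "p < a + 2 * k" for p
      proof -
        have "p \<noteq> \<alpha> u" if "u < k" for u
        proof -
          have "u = i \<or> u < i" using that i_last by linarith
          then show ?thesis using less(1)[of u i] \<open>s < p\<close> i by auto
        qed
        then show ?thesis using cover[of p] that s by auto
      qed
      moreover have "s < a + 2 * k - 2" "s < a + 2 * k - 1"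
        "a + 2 * k - 2 < a + 2 * k" "a + 2 * k - 1 < a + 2 * k"
        using s by linarith+
      ultimately obtain u v
        where uv: "u < k" "v < k" "a + 2 * k - 2 = \<beta> u" "a + 2 * k - 1 = \<beta> v" by metis
      then have "u < v" using less(2)[of v u] s by (cases u v rule: linorder_cases) auto
      then have "u < i" using i_last uv by simp
      then have "R (\<beta> u) (\<beta> i)"
        using right[OF _ less(2)[of u i] range(2)[of i]] uv s i by simp
      then show False using no_before[OF \<open>u < i\<close>] by simp
    qed
  qed
  note isolated_in_first = this
  assume tw: "twin_enumerations R a k \<alpha> \<beta>"
  have "s \<in> \<alpha> ` {..<k} \<union> \<beta> ` {..<k}"
    using tw s by (simp add: twin_enumerations_def)
  then show False
    using isolated_in_first[OF tw] isolated_in_first[OF twin_enumerations_sym[OF tw]] by auto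
qed

text \<open>
  A half that meets \<open>D\<close> at least twice has all its indices in \<open>D\<close> recognisable as the non-isolated
  vertices of its inversion graph. So the two halves meet \<open>D\<close> in the same set of indices as soon as
  one of them meets it twice, which is forced by \<open>card D \<ge> 3\<close>; then \<open>card D\<close> is even.
\<close>

lemma no_twins_with_one_odd_clique:
  assumes D: "D \<subseteq> {a..<a + 2 * k}" "odd (card D)" "card D \<ge> 3"
    and R: "\<And>p q. a \<le> p \<Longrightarrow> p < q \<Longrightarrow> q < a + 2 * k \<Longrightarrow> R p q \<longleftrightarrow> p \<in> D \<and> q \<in> D"
  shows "\<not> twin_enumerations R a k \<alpha> \<beta>"
proof
  define I where "I \<gamma> = {i. i < k \<and> \<gamma> i \<in> D}" for \<gamma> :: "nat \<Rightarrow> nat"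
  have sub: "I \<alpha> \<subseteq> I \<beta>"
    if tw: "twin_enumerations R a k \<alpha> \<beta>" and two: "card (I \<alpha>) \<ge> 2" for \<alpha> \<beta>
  proof
    fix i assume i: "i \<in> I \<alpha>"
    have RD: "R (\<gamma> u) (\<gamma> v) \<longleftrightarrow> \<gamma> u \<in> D \<and> \<gamma> v \<in> D"
      if "\<gamma> = \<alpha> \<or> \<gamma> = \<beta>" "u < v" "v < k" for \<gamma> u v
    proof (rule R)
      have "\<gamma> ` {..<k} \<subseteq> {a..<a + 2 * k}"
        using tw that(1) unfolding twin_enumerations_def by blast
      then show "a \<le> \<gamma> u" "\<gamma> v < a + 2 * k" using that by (auto simp: image_subset_iff)
      show "\<gamma> u < \<gamma> v"
        using tw that by (auto simp: twin_enumerations_def strict_mono_on_def)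
    qed
    have same: "\<alpha> u \<in> D \<and> \<alpha> v \<in> D \<longleftrightarrow> \<beta> u \<in> D \<and> \<beta> v \<in> D" if "u < v" "v < k" for u v
      using tw that RD[of \<alpha> u v] RD[of \<beta> u v] unfolding twin_enumerations_def by blast
    have "\<not> I \<alpha> \<subseteq> {i}"
      using two card_mono[of "{i}" "I \<alpha>"] by auto
    then obtain j where j: "j \<in> I \<alpha>" "j \<noteq> i" by blast
    with i same[of i j] same[of j i] show "i \<in> I \<beta>"
      unfolding I_def by (cases i j rule: linorder_cases) auto
  qed
  assume tw: "twin_enumerations R a k \<alpha> \<beta>"
  have card: "card (I \<alpha>) + card (I \<beta>) = card D"
  proof -
    have inj: "inj_on \<gamma> (I \<gamma>)" if "\<gamma> = \<alpha> \<or> \<gamma> = \<beta>" for \<gamma>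
      using tw that unfolding twin_enumerations_def I_def
      by (auto intro!: inj_on_subset[OF strict_mono_on_imp_inj_on, of "{..<k}"])
    have "D = \<alpha> ` I \<alpha> \<union> \<beta> ` I \<beta>"
    proof -
      have "D \<subseteq> \<alpha> ` {..<k} \<union> \<beta> ` {..<k}"
        using tw D by (simp add: twin_enumerations_def)
      then show ?thesis unfolding I_def by auto
    qed
    moreover have "\<alpha> ` I \<alpha> \<inter> \<beta> ` I \<beta> = {}"
      using tw unfolding twin_enumerations_def I_def by blast
    moreover have "finite (I \<gamma>)" for \<gamma>
      unfolding I_def by simp
    ultimately show ?thesis
      using inj[of \<alpha>] inj[of \<beta>] by (simp add: card_Un_disjoint card_image)
  qed
  have eq: "I \<alpha> = I \<beta>"
    if tw: "twin_enumerations R a k \<alpha> \<beta>" and two: "card (I \<alpha>) \<ge> 2" for \<alpha> \<beta>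
  proof -
    have "I \<alpha> \<subseteq> I \<beta>" using sub[OF tw two] .
    moreover have "card (I \<beta>) \<ge> 2"
      using two card_mono[OF _ \<open>I \<alpha> \<subseteq> I \<beta>\<close>] by (simp add: I_def)
    ultimately show ?thesis using sub[OF twin_enumerations_sym[OF tw]] by auto
  qed
  have "card (I \<alpha>) \<ge> 2 \<or> card (I \<beta>) \<ge> 2" using card D by linarith
  then have "I \<alpha> = I \<beta>" using eq[OF tw] eq[OF twin_enumerations_sym[OF tw], symmetric] by blast
  then show False using card D by (metis mult_2 even_mult_iff even_numeral)
qed

section \<open>The layered permutation\<close>

text \<open>
  Reflecting the residues modulo \<open>m\<close> fixes \<open>0\<close> and reverses \<open>1, \<dots>, m - 1\<close>. So the blocks have
  sizes \<open>1, m - 1, 1, m - 1, \<dots>\<close>.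
\<close>

definition layered :: "nat \<Rightarrow> nat \<Rightarrow> nat" where
  "layered m p = m * (p div m) + (m - p mod m) mod m"

lemma layered_less_iff:
  assumes "m > 0" "p < q"
  shows "layered m p < layered m q \<longleftrightarrow> \<not> (p div m = q div m \<and> p mod m \<noteq> 0)"
proof (cases "p div m = q div m")
  case True
  then have "p mod m < q mod m"
    using assms(2) by (metis div_mult_mod_eq nat_add_left_cancel_less)
  moreover have "q mod m < m" using assms by simp
  ultimately show ?thesis using True by (cases "p mod m = 0") (auto simp: layered_def)
next
  case False
  then have "Suc (p div m) \<le> q div m"
    using div_le_mono[of p q m] assms by simp
  then have "m * Suc (p div m) \<le> m * (q div m)" by (rule mult_le_mono2)
  moreover have "(m - p mod m) mod m < m" using assms by simp
  ultimately have "layered m p < layered m q" unfolding layered_def by simp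
  with False show ?thesis by simp
qed

lemma inj_layered:
  assumes "m > 0"
  shows "inj (layered m)"
proof (rule linorder_injI)
  fix p q :: nat assume "p < q"
  show "layered m p \<noteq> layered m q"
  proof
    assume eq: "layered m p = layered m q"
    then have same: "p div m = q div m" "p mod m \<noteq> 0"
      using layered_less_iff[OF assms \<open>p < q\<close>] by auto
    then have "p mod m < q mod m"
      using \<open>p < q\<close> by (metis div_mult_mod_eq nat_add_left_cancel_less)
    moreover have "q mod m < m" using assms by simp
    ultimately show False using eq same by (simp add: layered_def)
  qed
qed

lemma layered_no_twin_enumerations:
  assumes k: "k \<ge> 3"
  shows "\<not> twin_enumerations (\<lambda>p q. \<not> layered (2 * k - 2) p < layered (2 * k - 2) q) a k \<alpha> \<beta>"
proof -
  define m where "m = 2 * k - 2"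
  define R where "R p q \<longleftrightarrow> \<not> layered m p < layered m q" for p q
  have m: "m > 0" and k2: "2 * k = m + 2" "m \<ge> 4" using k by (auto simp: m_def)
  have div_eq: "p div m = c" if "m * c \<le> p" "p < m * c + m" for p c
    using that by (intro div_nat_eqI) (auto simp: algebra_simps)
  have mod_eq: "p mod m = p - m * c" if "m * c \<le> p" "p < m * c + m" for p c
    using div_eq[OF that] by (simp add: minus_mult_div_eq_mod[symmetric])
  have R_iff: "R p q \<longleftrightarrow> p div m = q div m \<and> p mod m \<noteq> 0" if "p < q" for p q
    using layered_less_iff[OF m that] by (auto simp: R_def)
  have R_block: "R p q" if "m * c < p" "p < q" "q < m * c + m" for p q c
    using R_iff[OF \<open>p < q\<close>] div_eq[of c p] div_eq[of c q] mod_eq[of c p] that by simp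
  have R_single_left: "\<not> R (m * c) p" if "m * c < p" for c p
    using R_iff[OF that] by simp
  have R_single_right: "\<not> R p (m * c)" if "p < m * c" for c p
  proof -
    have "p div m < c" using that by (simp add: div_less_iff_less_mult m mult.commute)
    then show ?thesis using R_iff[OF that] m by simp
  qed
  define c where "c = a div m"
  define r where "r = a mod m"
  have a: "a = m * c + r" by (simp add: c_def r_def)
  have "r < m" using m by (simp add: r_def)
  \<comment> \<open>The singleton blocks of the window are \<open>m * c\<close> (if \<open>r = 0\<close>), \<open>m * (c + 1)\<close>, and
    \<open>m * (c + 2)\<close> (if \<open>r + 1 = m\<close>); only in the extreme cases is the middle one near the border.\<close>
  then consider "1 \<le> r" "r + 2 \<le> m" | "r = 0" | "r + 1 = m" by linarith
  then have "\<not> twin_enumerations R a k \<alpha> \<beta>"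
  proof cases
    case 1
    show ?thesis
    proof (rule no_twins_around_isolated_position[where s = "m * (c + 1)"])
      show "a + 2 \<le> m * (c + 1)" "m * (c + 1) + 3 \<le> a + 2 * k" using a 1 k2 by auto
      show "R p q" if "a \<le> p" "p < q" "q < m * (c + 1)" for p q
        using that a 1 by (intro R_block[of c]) auto
      show "R p q" if "m * (c + 1) < p" "p < q" "q < a + 2 * k" for p q
        using that a 1 k2 by (intro R_block[of "c + 1"]) auto
      show "\<not> R p (m * (c + 1))" if "p < m * (c + 1)" for p
        using R_single_right[OF that] .
      show "\<not> R (m * (c + 1)) p" if "m * (c + 1) < p" for p
        using R_single_left[OF that] .
    qed
  next
    case 2
    show ?thesis
    proof (rule no_twins_with_one_odd_clique[where D = "{m * c + 1..<m * c + m}"])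
      show "{m * c + 1..<m * c + m} \<subseteq> {a..<a + 2 * k}" using a 2 k2 by auto
      show "odd (card {m * c + 1..<m * c + m})" "3 \<le> card {m * c + 1..<m * c + m}"
        using k by (auto simp: m_def)
      show "R p q \<longleftrightarrow> p \<in> {m * c + 1..<m * c + m} \<and> q \<in> {m * c + 1..<m * c + m}"
        if "a \<le> p" "p < q" "q < a + 2 * k" for p q
      proof -
        have "m * c \<le> p" "q < m * c + m + 2" using that a 2 k2 by auto
        then consider "p = m * c" | "m * c < p" "q < m * c + m" | "q = m * (c + 1)"
          | "p = m * (c + 1)" | "m * c < p" "p < m * (c + 1)" "q = m * (c + 1) + 1"
          using \<open>p < q\<close> by force
        then show ?thesis
        proof cases
          case 1
          then show ?thesis using R_single_left[of c q] \<open>p < q\<close> by simp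
        next
          case 2
          then show ?thesis using R_block[OF 2(1) \<open>p < q\<close> 2(2)] \<open>p < q\<close> by simp
        next
          case 3
          then show ?thesis using R_single_right[of p "c + 1"] \<open>p < q\<close> by simp
        next
          case 4
          then show ?thesis using R_single_left[of "c + 1" q] \<open>p < q\<close> by simp
        next
          case 5
          then show ?thesis
            using R_iff[OF \<open>p < q\<close>] div_eq[of c p] div_eq[of "c + 1" q] k2 by simp
        qed
      qed
    qed
  next
    case 3
    define d where "d = c + 1"
    have a': "a + 1 = m * d" using a 3 by (simp add: d_def)
    show ?thesis
    proof (rule no_twins_with_one_odd_clique[where D = "{m * d + 1..<m * d + m}"])
      show "{m * d + 1..<m * d + m} \<subseteq> {a..<a + 2 * k}" using a' k2 by auto
      show "odd (card {m * d + 1..<m * d + m})" "3 \<le> card {m * d + 1..<m * d + m}"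
        using k by (auto simp: m_def)
      show "R p q \<longleftrightarrow> p \<in> {m * d + 1..<m * d + m} \<and> q \<in> {m * d + 1..<m * d + m}"
        if "a \<le> p" "p < q" "q < a + 2 * k" for p q
      proof -
        have "m * d \<le> p + 1" "q \<le> m * d + m" using that a' k2 by auto
        then consider "p = m * d" | "q = m * d" | "m * d < p" "q < m * d + m" | "q = m * (d + 1)"
          | "p < m * d" "m * d < q" "q < m * (d + 1)"
          using \<open>p < q\<close> by force
        then show ?thesis
        proof cases
          case 1
          then show ?thesis using R_single_left[of d q] \<open>p < q\<close> by simp
        next
          case 2
          then show ?thesis using R_single_right[of p d] \<open>p < q\<close> by simp
        next
          case 3
          then show ?thesis using R_block[OF 3(1) \<open>p < q\<close> 3(2)] \<open>p < q\<close> by simp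
        next
          case 4
          then show ?thesis using R_single_right[of p "d + 1"] \<open>p < q\<close> by simp
        next
          case 5
          then have "p div m < d" by (simp add: div_less_iff_less_mult m mult.commute)
          then show ?thesis
            using R_iff[OF \<open>p < q\<close>] div_eq[of d q] 5 by simp
        qed
      qed
    qed
  qed
  then show ?thesis unfolding R_def m_def .
qed

theorem proposition4p3:
  fixes k :: nat
  assumes "k \<ge> 3"
  shows "tight_twin_number 2 k = \<infinity>"
proof -
  have "\<not> forces_tight_twins 2 k n" for n
  proof
    define xs where "xs = map (\<lambda>p. int (layered (2 * k - 2) p)) [0..<n]"
    have "inj (layered (2 * k - 2))" using assms by (intro inj_layered) simp
    then have "permutation xs"
      unfolding permutation_def xs_def by (auto simp: distinct_map inj_on_def)
    moreover assume "forces_tight_twins 2 k n"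
    ultimately obtain P where "is_tight_twins 2 k xs P"
      unfolding forces_tight_twins_def contains_tight_twins_def by (auto simp: xs_def)
    then obtain a \<alpha> \<beta> where a: "a + 2 * k \<le> length xs"
      and tw: "twin_enumerations (\<lambda>p q. \<not> xs ! p < xs ! q) a k \<alpha> \<beta>"
      by (rule tight_twins_enumerations)
    have "xs ! \<gamma> i = int (layered (2 * k - 2) (\<gamma> i))" if "\<gamma> = \<alpha> \<or> \<gamma> = \<beta>" "i < k" for \<gamma> i
    proof -
      have "\<gamma> ` {..<k} \<subseteq> {a..<a + 2 * k}"
        using tw that(1) unfolding twin_enumerations_def by blast
      then have "\<gamma> i < n" using that(2) a by (auto simp: xs_def)
      then show ?thesis by (simp add: xs_def)
    qed
    then have "twin_enumerations
        (\<lambda>p q. \<not> layered (2 * k - 2) p < layered (2 * k - 2) q) a k \<alpha> \<beta>"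
      using tw unfolding twin_enumerations_def by simp
    then show False using layered_no_twin_enumerations[OF assms] by blast
  qed
  then show ?thesis by (simp add: tight_twin_number_def)
qed

end
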